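(* Let $S=\langle L,\leq,\top,\bot,\Box,\boxtimes\rangle$ be a meet APS. Then for every one-variable meet APS term $\triangle v$, if $\mathsf{E}_S(\boxtimes)$ holds, then $\mathsf{E}_S(\triangle)$ holds.
   Context: An abstract provability structure (APS) is a tuple $S=\langle L,\leq,\top,\bot,\Box,\boxtimes\rangle$ where $L$ is a nonempty set, $\leq$ is a partial order on $L$, $\top,\bot\in L$, and $\Box,\boxtimes$ are unary operations on $L$ such that for all $x,y\in L$: (C1) if $x\leq y$ then $\Box x\leq\Box y$ and $\boxtimes y\leq\boxtimes x$; (C2) $\top\leq\boxtimes\bot$; (C3) if $x\leq\Box y$ and $x\leq\boxtimes y$ then $x\leq\boxtimes\top$; (C4) $\boxtimes x\leq\Box\boxtimes x$; (C5) $x\leq\top$. (It is not assumed that $\bot$ is the least element.) A meet APS is an APS for which $\langle L,\leq\rangle$ is a meet-semilattice; $x\land y$ denotes the meet. A one-variable meet APS term $\triangle v$ is generated from the variable $v$ by finitely many applications of $\Box$, $\boxtimes$, and $\land$; it induces a unary operation $x\mapsto\triangle x$ on $L$. $\mathsf{E}_S(\triangle)$ means "$\triangle v$ has a fixed point in $S$", i.e. there is $p\in L$ with $\triangle p=p$; in particular $\mathsf{E}_S(\boxtimes)$ means there is $p\in L$ with $p=\boxtimes p$. *)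

theory Defs
  imports "HOL-Algebra.Lattice"
begin

text \<open>The distinguished elements are plain record fields, named \<open>verum\<close> and \<open>falsum\<close>, and not
  \<open>\<top>\<close> and \<open>\<bottom>\<close> of \<open>HOL-Algebra.Order\<close>: those denote the greatest and the least element of the
  carrier, whereas \<open>falsum\<close> is not required to be least.\<close>

record 'a aps = "'a gorder" +
  verum :: 'a
  falsum :: 'a
  box :: "'a \<Rightarrow> 'a"
  boxtimes :: "'a \<Rightarrow> 'a"

text \<open>\<open>partial_order\<close> makes the equality of the structure the logical equality;
  nonemptiness of the carrier is implied by \<open>verum_closed\<close>.\<close>

locale aps = partial_order S for S :: "('a, 'm) aps_scheme" (structure) +
  assumes verum_closed: "verum S \<in> carrier S"
    and falsum_closed: "falsum S \<in> carrier S"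
    and box_closed: "x \<in> carrier S \<Longrightarrow> box S x \<in> carrier S"
    and boxtimes_closed: "x \<in> carrier S \<Longrightarrow> boxtimes S x \<in> carrier S"
    and C1_box: "\<lbrakk>x \<in> carrier S; y \<in> carrier S; x \<sqsubseteq> y\<rbrakk> \<Longrightarrow> box S x \<sqsubseteq> box S y"
    and C1_boxtimes: "\<lbrakk>x \<in> carrier S; y \<in> carrier S; x \<sqsubseteq> y\<rbrakk> \<Longrightarrow> boxtimes S y \<sqsubseteq> boxtimes S x"
    and C2: "verum S \<sqsubseteq> boxtimes S (falsum S)"
    and C3: "\<lbrakk>x \<in> carrier S; y \<in> carrier S; x \<sqsubseteq> box S y; x \<sqsubseteq> boxtimes S y\<rbrakk>
               \<Longrightarrow> x \<sqsubseteq> boxtimes S (verum S)"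
    and C4: "x \<in> carrier S \<Longrightarrow> boxtimes S x \<sqsubseteq> box S (boxtimes S x)"
    and C5: "x \<in> carrier S \<Longrightarrow> x \<sqsubseteq> verum S"

locale meet_aps = aps + lower_semilattice S

datatype aps_term =
    Var
  | Box aps_term
  | Boxtimes aps_term
  | Meet aps_term aps_term

primrec eval :: "('a, 'm) aps_scheme \<Rightarrow> aps_term \<Rightarrow> 'a \<Rightarrow> 'a" where
  "eval S Var x = x"
| "eval S (Box t) x = box S (eval S t x)"
| "eval S (Boxtimes t) x = boxtimes S (eval S t x)"
| "eval S (Meet t u) x = eval S t x \<sqinter>\<^bsub>S\<^esub> eval S u x"

definition has_fixed_point :: "('a, 'm) aps_scheme \<Rightarrow> aps_term \<Rightarrow> bool" where
  "has_fixed_point S t \<longleftrightarrow> (\<exists>p\<in>carrier S. eval S t p = p)"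

end

theory Submission
  imports Defs "HOL-Library.Extended_Nat"
begin

text \<open>A fixed point \<open>p\<close> of \<open>\<boxtimes>\<close> satisfies \<open>p \<le> \<box>p\<close> by (C4), hence \<open>p = \<boxtimes>\<top>\<close> by (C3) and antitonicity.
  So \<open>q = \<boxtimes>\<top>\<close> is itself fixed by \<open>\<boxtimes>\<close>, and \<open>\<boxtimes>\<close> takes the constant value \<open>q\<close> above \<open>q\<close>. The chain
  \<open>q \<le> \<box>q \<le> \<box>\<box>q \<le> \<dots> \<le> \<top>\<close>, in which \<open>\<box>\<top> = \<top>\<close>, is therefore closed under all three operations, which
  act on the exponents in \<open>\<nat> \<union> {\<infinity>}\<close> as \<open>n \<mapsto> n + 1\<close>, \<open>n \<mapsto> 0\<close> and \<open>min\<close>. A term thus induces a function \<open>f\<close>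
  on exponents with \<open>min n (f \<infinity>) \<le> f n \<le> f \<infinity>\<close>, so \<open>f \<infinity>\<close> is a fixed point of \<open>f\<close>.\<close>

primrec exponent :: "aps_term \<Rightarrow> enat \<Rightarrow> enat" where
  "exponent Var n = n"
| "exponent (Box t) n = eSuc (exponent t n)"
| "exponent (Boxtimes t) n = 0"
| "exponent (Meet t u) n = min (exponent t n) (exponent u n)"

lemma exponent_le_exponent_infinity: "exponent t n \<le> exponent t \<infinity>"
  by (induction t) (auto simp: min.coboundedI1 min.coboundedI2)

lemma min_le_exponent: "min n (exponent t \<infinity>) \<le> exponent t n"
proof (induction t)
  case (Box t)
  \<comment> \<open>If the right-hand minimum is \<open>n\<close>, this is
    \<open>n \<le> eSuc n\<close>; otherwise the right side is
    \<open>eSuc (exponent t \<infinity>)\<close>.\<close>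
  have "min n (eSuc (exponent t \<infinity>)) \<le> eSuc (min n (exponent t \<infinity>))"
    by (auto simp: min_def intro: order_trans[OF _ ile_eSuc])
  with Box show ?case
    by (metis eSuc_ile_mono exponent.simps(2) order_trans)
qed (auto simp: min_le_iff_disj)

lemma exponent_fixed_point: "exponent t (exponent t \<infinity>) = exponent t \<infinity>"
  using exponent_le_exponent_infinity[of t "exponent t \<infinity>"] min_le_exponent[of "exponent t \<infinity>" t]
  by simp

context aps
begin

text \<open>(C2) and (C5) make \<open>verum S\<close> a value of \<open>boxtimes S\<close>, so (C4)
  applies to it.\<close>

lemma box_verum: "box S (verum S) = verum S"
proof -
  have "boxtimes S (falsum S) = verum S"
    using C2 C5 by (simp add: boxtimes_closed falsum_closed le_antisym verum_closed)
  then have "verum S \<sqsubseteq> box S (verum S)"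
    using C4[OF falsum_closed] by simp
  then show ?thesis
    using C5 by (simp add: box_closed le_antisym verum_closed)
qed

lemma boxtimes_fixed_point_eq:
  assumes "p \<in> carrier S" and "boxtimes S p = p"
  shows "p = boxtimes S (verum S)"
proof (rule le_antisym)
  have "p \<sqsubseteq> box S p"
    using C4[OF assms(1)] assms(2) by simp
  then show "p \<sqsubseteq> boxtimes S (verum S)"
    using C3[of p p] assms by simp
  show "boxtimes S (verum S) \<sqsubseteq> p"
    using C1_boxtimes[OF assms(1) verum_closed] C5 assms by simp
qed (simp_all add: assms boxtimes_closed verum_closed)

text \<open>Since \<open>eSuc \<infinity> = \<infinity>\<close>, the value at \<infinity> must be
  fixed by \<open>box S\<close>; it bounds the finite powers but need not be their supremum.\<close>

definition box_power :: "enat \<Rightarrow> 'a" where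
  "box_power n = (case n of enat k \<Rightarrow> (box S ^^ k) (boxtimes S (verum S)) | \<infinity> \<Rightarrow> verum S)"

lemma box_power_0: "box_power 0 = boxtimes S (verum S)"
  by (simp add: box_power_def zero_enat_def)

lemma box_power_infinity: "box_power \<infinity> = verum S"
  by (simp add: box_power_def)

lemma box_power_eSuc: "box_power (eSuc n) = box S (box_power n)"
  by (cases n) (simp_all add: box_power_def eSuc_enat box_verum)

lemma box_power_closed: "box_power n \<in> carrier S"
proof (cases n)
  case (enat k)
  have "(box S ^^ k) (boxtimes S (verum S)) \<in> carrier S"
    by (induction k) (simp_all add: box_closed boxtimes_closed verum_closed)
  with enat show ?thesis by (simp add: box_power_def)
qed (simp add: box_power_def verum_closed)

lemma box_power_le_eSuc: "box_power (enat k) \<sqsubseteq> box_power (eSuc (enat k))"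
proof (induction k)
  case 0
  show ?case
    using C4[OF verum_closed] by (simp add: box_power_eSuc box_power_0 flip: zero_enat_def)
next
  case (Suc k)
  then show ?case
    using C1_box[OF box_power_closed box_power_closed]
    by (metis box_power_eSuc eSuc_enat)
qed

lemma box_power_mono:
  assumes "m \<le> n"
  shows "box_power m \<sqsubseteq> box_power n"
proof (cases n)
  case (enat l)
  with assms obtain k where k: "m = enat k" "k \<le> l"
    by (cases m) auto
  from \<open>k \<le> l\<close> have "box_power (enat k) \<sqsubseteq> box_power (enat l)"
  proof (induction rule: dec_induct)
    case (step i)
    then show ?case
      using box_power_le_eSuc[of i] by (auto simp: eSuc_enat intro: le_trans box_power_closed)
  qed (simp add: box_power_closed)
  with k enat show ?thesis by simp
qed (simp add: box_power_infinity C5 box_power_closed)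

text \<open>The antitone \<open>boxtimes S\<close> agrees at \<open>box_power 0\<close> and
  \<open>verum S\<close>, hence at everything between.\<close>

lemma boxtimes_box_power:
  assumes "boxtimes S (boxtimes S (verum S)) = boxtimes S (verum S)"
  shows "boxtimes S (box_power n) = box_power 0"
proof (rule le_antisym)
  show "boxtimes S (box_power n) \<sqsubseteq> box_power 0"
    using C1_boxtimes[OF box_power_closed box_power_closed box_power_mono[of 0 n]] assms
    by (simp add: box_power_0)
  show "box_power 0 \<sqsubseteq> boxtimes S (box_power n)"
    using C1_boxtimes[OF box_power_closed verum_closed C5] by (simp add: box_power_0 box_power_closed)
qed (simp_all add: box_power_closed boxtimes_closed)

end

context meet_aps
begin

lemma meet_box_power: "box_power m \<sqinter> box_power n = box_power (min m n)"
proof -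
  have *: "box_power m \<sqinter> box_power n = box_power m" if "m \<le> n" for m n
    using box_power_mono[OF that] by (simp add: box_power_closed le_antisym meet_le meet_left)
  show ?thesis
    using *[of m n] *[of n m] by (auto simp: min_def meet_comm)
qed

text \<open>Thus \<open>box_power\<close> carries fixed points of \<open>exponent t\<close> to fixed
  points of \<open>eval S t\<close>.\<close>

lemma eval_box_power:
  assumes "boxtimes S (boxtimes S (verum S)) = boxtimes S (verum S)"
  shows "eval S t (box_power n) = box_power (exponent t n)"
  by (induction t) (simp_all add: box_power_eSuc boxtimes_box_power[OF assms] meet_box_power)

end

theorem proposition7p8:
  fixes S :: "('a, 'm) aps_scheme" and t :: aps_term
  assumes "meet_aps S"
    and "has_fixed_point S (Boxtimes Var)"
  shows "has_fixed_point S t"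
proof -
  interpret meet_aps S by fact
  obtain p where "p \<in> carrier S" "boxtimes S p = p"
    using assms(2) by (auto simp: has_fixed_point_def)
  then have "boxtimes S (boxtimes S (verum S)) = boxtimes S (verum S)"
    using boxtimes_fixed_point_eq by metis
  then have "eval S t (box_power (exponent t \<infinity>)) = box_power (exponent t \<infinity>)"
    by (simp add: eval_box_power exponent_fixed_point)
  then show ?thesis
    unfolding has_fixed_point_def using box_power_closed by blast
qed

end
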